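(* For $n\ge0$ let $L_n(x)=\sum_{k\ge0}L(n,k)x^k$, where $L(n,k)$ is the number of permutations of $[n]$ whose total number of occurrences of the consecutive patterns $231$ and $321$ is $k$. Then $$\sum_{n=0}^{\infty}L_n(x)\frac{t^n}{n!}=\frac{e^{\frac{t(t+2)(1-x)}{2}}}{1+x\,e^{\frac{x-1}{2}}\int_{t+1}^{1}e^{\frac{1-x}{2}s^2}\,ds}.$$
   Context: $[n]=\{1,\dots,n\}$. For a permutation $\pi=\pi_1\cdots\pi_n$ of $[n]$ and a permutation $\sigma$ of $[m]$, an occurrence of the consecutive pattern $\sigma$ in $\pi$ is a block $\pi_{i+1}\pi_{i+2}\cdots\pi_{i+m}$ ($0\le i\le n-m$) of consecutive entries whose entries are in the same relative order as $\sigma_1\cdots\sigma_m$. Thus an occurrence of the consecutive pattern $231$ or $321$ is an index $2\le i\le n-1$ with $\pi_{i-1}<\pi_i>\pi_{i+1}$ and $\pi_{i-1}>\pi_{i+1}$, or with $\pi_{i-1}>\pi_i>\pi_{i+1}$, respectively. The identity is one of power series in $t$, the right-hand side being expanded at $t=0$. The empty permutation is counted for $n=0$. *)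

theory Defs
  imports
    "HOL-Combinatorics.Multiset_Permutations"
    "HOL-Complex_Analysis.Complex_Analysis"
begin

text \<open>
  Permutations of \<open>[n]\<close> are words in one-line notation, that is, elements of
  \<open>permutations_of_set {1..n}\<close>. A pattern is a word as well.
  List positions start at 0, so an offset \<open>i\<close> marks the block
  \<open>\<pi>\<^sub>i\<^sub>+\<^sub>1 \<dots> \<pi>\<^sub>i\<^sub>+\<^sub>m\<close> in the usual indexing.
\<close>

definition consec_occurrences :: "nat list \<Rightarrow> nat list \<Rightarrow> nat set" where
  "consec_occurrences \<sigma> \<pi> =
     {i. i + length \<sigma> \<le> length \<pi> \<and>
         (\<forall>a<length \<sigma>. \<forall>b<length \<sigma>. \<pi> ! (i + a) < \<pi> ! (i + b) \<longleftrightarrow> \<sigma> ! a < \<sigma> ! b)}"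

definition occ_231_321 :: "nat list \<Rightarrow> nat" where
  "occ_231_321 \<pi> =
     card (consec_occurrences [2, 3, 1] \<pi>) + card (consec_occurrences [3, 2, 1] \<pi>)"

definition L_count :: "nat \<Rightarrow> nat \<Rightarrow> nat" where
  "L_count n k = card {\<pi> \<in> permutations_of_set {1..n}. occ_231_321 \<pi> = k}"

text \<open>
  For each \<open>n\<close> only finitely many \<open>L_count n k\<close> are nonzero, so the series below is a
  finite sum (lemma \<open>L_poly_eq_sum\<close>).
\<close>

definition L_poly :: "nat \<Rightarrow> complex \<Rightarrow> complex" where
  "L_poly n x = (\<Sum>k. of_nat (L_count n k) * x ^ k)"

lemma finite_L_count_nonzero: "finite {k. L_count n k \<noteq> 0}"
proof (rule finite_subset)
  show "{k. L_count n k \<noteq> 0} \<subseteq> occ_231_321 ` permutations_of_set {1..n}"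
  proof
    fix k assume "k \<in> {k. L_count n k \<noteq> 0}"
    then have "{\<pi> \<in> permutations_of_set {1..n}. occ_231_321 \<pi> = k} \<noteq> {}"
      unfolding L_count_def by (metis (mono_tags) card.empty mem_Collect_eq)
    then show "k \<in> occ_231_321 ` permutations_of_set {1..n}" by blast
  qed
qed simp

lemma L_poly_eq_sum: "L_poly n x = (\<Sum>k | L_count n k \<noteq> 0. of_nat (L_count n k) * x ^ k)"
  unfolding L_poly_def by (rule suminf_finite[OF finite_L_count_nonzero]) simp

end

theory Submission
  imports Defs
begin

text \<open>
  An occurrence of 231 or 321 is a block of three consecutive entries whose last entry is its
  minimum. Split a word at its least entry \<open>m\<close> as \<open>\<alpha> @ m # \<beta>\<close>. The blocks inside \<open>\<alpha>\<close> and inside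
  \<open>\<beta>\<close> are unaffected, the block ending at \<open>m\<close> is an occurrence as soon as it exists, that is, as
  soon as \<open>\<alpha>\<close> has two entries, and a block that starts at \<open>m\<close> or has it in the middle is never one
  (lemma \<open>occ_split_at_least\<close>). As \<open>\<alpha>\<close> and \<open>\<beta>\<close> are arbitrary words on complementary sets of
  letters, the numbers \<open>c\<^sub>n = L\<^sub>n(x) / n!\<close> satisfy
  \<open>(n + 1) c\<^sub>n\<^sub>+\<^sub>1 = (\<Sum>k\<le>n. x\<^bsup>[k \<ge> 2]\<^esup> c\<^sub>k c\<^sub>n\<^sub>-\<^sub>k)\<close>, which determines them
  from \<open>c\<^sub>0 = 1\<close> (lemma \<open>occ_weight_eq\<close>).

  Write the factor \<open>x\<^bsup>[k \<ge> 2]\<^esup>\<close> as \<open>x + (1 - x) [k < 2]\<close>. Because \<open>c\<^sub>0 = c\<^sub>1 = 1\<close>, the recurrence is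
  the coefficientwise form of the Bernoulli equation \<open>F' = (1 - x) (1 + t) F + x F\<^sup>2\<close>
  (lemma \<open>bernoulli_fps_coeffs\<close>). The quotient in the theorem solves this equation with
  value 1 at 0: its numerator \<open>N\<close> satisfies \<open>N' = (1 - x) (1 + t) N\<close>, and its denominator \<open>D\<close>
  satisfies \<open>D' = - x N\<close> by the fundamental theorem of calculus, so that
  \<open>(N / D)' = N' / D + x (N / D)\<^sup>2\<close>.
\<close>

section \<open>Splitting a word at its least letter\<close>

lemma consec_occurrences_Cons:
  "consec_occurrences \<sigma> (a # xs) =
     (if 0 \<in> consec_occurrences \<sigma> (a # xs) then {0} else {}) \<union> Suc ` consec_occurrences \<sigma> xs"
proof -
  have "Suc j \<in> consec_occurrences \<sigma> (a # xs) \<longleftrightarrow> j \<in> consec_occurrences \<sigma> xs" for j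
    by (simp add: consec_occurrences_def)
  then have "i \<in> consec_occurrences \<sigma> (a # xs) \<longleftrightarrow>
      i \<in> (if 0 \<in> consec_occurrences \<sigma> (a # xs) then {0} else {}) \<union> Suc ` consec_occurrences \<sigma> xs"
    for i by (cases i) auto
  then show ?thesis by blast
qed

lemma finite_consec_occurrences [simp]: "finite (consec_occurrences \<sigma> \<pi>)"
  by (rule finite_subset[of _ "{..length \<pi>}"]) (auto simp: consec_occurrences_def)

lemma card_consec_occurrences_Cons:
  "card (consec_occurrences \<sigma> (a # xs)) =
     (if 0 \<in> consec_occurrences \<sigma> (a # xs) then 1 else 0) + card (consec_occurrences \<sigma> xs)"
  by (subst consec_occurrences_Cons) (simp add: card_image)

lemma occ_231_321_short: "length \<pi> < 3 \<Longrightarrow> occ_231_321 \<pi> = 0"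
  by (simp add: occ_231_321_def consec_occurrences_def)

text \<open>
  Without distinctness a block such as 2 2 1 would end in its minimum and match neither pattern.
\<close>

lemma occ_231_321_Cons3:
  assumes "distinct [a, b, c]"
  shows "occ_231_321 (a # b # c # r) = (if c < a \<and> c < b then 1 else 0) + occ_231_321 (b # c # r)"
proof -
  have all3: "(\<forall>i<Suc (Suc (Suc 0)). P i) \<longleftrightarrow> P 0 \<and> P 1 \<and> P 2" for P :: "nat \<Rightarrow> bool"
    by (auto simp: less_Suc_eq numeral_2_eq_2)
  have "0 \<in> consec_occurrences [2, 3, 1] (a # b # c # r) \<longleftrightarrow> c < a \<and> a < b"
    using assms by (simp add: consec_occurrences_def all3) auto
  moreover have "0 \<in> consec_occurrences [3, 2, 1] (a # b # c # r) \<longleftrightarrow> c < b \<and> b < a"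
    using assms by (simp add: consec_occurrences_def all3) auto
  ultimately show ?thesis
    using assms unfolding occ_231_321_def
      card_consec_occurrences_Cons[of "[2, 3, 1]" a] card_consec_occurrences_Cons[of "[3, 2, 1]" a]
    by auto
qed

lemma occ_231_321_Cons_least:
  assumes "distinct (m # \<beta>)" "\<And>b. b \<in> set \<beta> \<Longrightarrow> m < b"
  shows "occ_231_321 (m # \<beta>) = occ_231_321 \<beta>"
proof (cases "length \<beta> < 2")
  case True
  then show ?thesis by (simp add: occ_231_321_short)
next
  case False
  then obtain b c r where "\<beta> = b # c # r"
    by (cases \<beta>; cases "tl \<beta>") auto
  then show ?thesis
    using assms by (subst \<open>\<beta> = _\<close>, subst occ_231_321_Cons3) (auto dest: order.asym)
qed

text \<open>
  Peeling letters off the front of \<open>\<alpha>\<close> changes both sides alike until only two are left; then the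
  block ending at \<open>m\<close> is peeled off, and what remains has \<open>m\<close> as its first or second letter.
\<close>

lemma occ_split_at_least:
  assumes "distinct (\<alpha> @ m # \<beta>)" "\<And>b. b \<in> set \<alpha> \<union> set \<beta> \<Longrightarrow> m < b"
  shows "occ_231_321 (\<alpha> @ m # \<beta>) =
           occ_231_321 \<alpha> + occ_231_321 \<beta> + (if 2 \<le> length \<alpha> then 1 else 0)"
  using assms
proof (induction \<alpha> rule: induct_list012)
  case 1
  then show ?case by (simp add: occ_231_321_Cons_least occ_231_321_short)
next
  case (2 a)
  have least: "occ_231_321 (m # \<beta>) = occ_231_321 \<beta>"
    using "2.prems" by (intro occ_231_321_Cons_least) auto
  show ?case
  proof (cases \<beta>)
    case Nil
    then show ?thesis by (simp add: occ_231_321_short)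
  next
    case (Cons b r)
    have "occ_231_321 (a # m # b # r) = occ_231_321 (m # b # r)"
      using "2.prems" Cons by (subst occ_231_321_Cons3) (auto dest: order.asym)
    then show ?thesis using least Cons by (simp add: occ_231_321_short)
  qed
next
  case (3 a b zs)
  have IH: "occ_231_321 ((b # zs) @ m # \<beta>) =
      occ_231_321 (b # zs) + occ_231_321 \<beta> + (if 2 \<le> length (b # zs) then 1 else 0)"
    using "3.prems" by (intro "3.IH"(2)) auto
  show ?case
  proof (cases zs)
    case Nil
    have "occ_231_321 (a # b # m # \<beta>) = 1 + occ_231_321 (b # m # \<beta>)"
      using "3.prems" Nil by (subst occ_231_321_Cons3) auto
    then show ?thesis using IH Nil by (simp add: occ_231_321_short)
  next
    case (Cons c r)
    have "distinct [a, b, c]" using "3.prems" Cons by auto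
    then show ?thesis using IH Cons by (simp add: occ_231_321_Cons3)
  qed
qed

section \<open>The recurrence\<close>

text \<open>
  The weights are defined for an arbitrary set of letters since the two parts of a split word are
  words on sets that are not intervals.
\<close>

definition occ_weight :: "complex \<Rightarrow> nat set \<Rightarrow> complex" where
  "occ_weight x A = (\<Sum>\<pi>\<in>permutations_of_set A. x ^ occ_231_321 \<pi>)"

lemma L_poly_eq_occ_weight: "L_poly n x = occ_weight x {1..n}"
proof -
  let ?P = "permutations_of_set {1..n}"
  have "L_poly n x = (\<Sum>k\<in>occ_231_321 ` ?P. of_nat (L_count n k) * x ^ k)"
    unfolding L_poly_def
  proof (rule suminf_finite)
    fix k assume "k \<notin> occ_231_321 ` ?P"
    then have "{\<pi> \<in> ?P. occ_231_321 \<pi> = k} = {}" by auto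
    then show "of_nat (L_count n k) * x ^ k = 0" by (simp only: L_count_def card.empty) simp
  qed simp
  also have "\<dots> = (\<Sum>k\<in>occ_231_321 ` ?P. \<Sum>\<pi>\<in>{\<pi> \<in> ?P. occ_231_321 \<pi> = k}. x ^ occ_231_321 \<pi>)"
    by (intro sum.cong) (simp_all add: L_count_def)
  also have "\<dots> = occ_weight x {1..n}"
    unfolding occ_weight_def by (rule sum.image_gen[symmetric]) simp
  finally show ?thesis .
qed

lemma sum_permutations_of_set_insert:
  assumes "m \<notin> A"
  shows "(\<Sum>\<pi>\<in>permutations_of_set (insert m A). f \<pi>) =
    (\<Sum>(B, \<alpha>, \<beta>)\<in>(SIGMA B:Pow A. permutations_of_set B \<times> permutations_of_set (A - B)).
       f (\<alpha> @ m # \<beta>))"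
proof (rule sum.reindex_bij_witness[where
      j = "\<lambda>\<pi>. (set (takeWhile (\<lambda>a. a \<noteq> m) \<pi>), takeWhile (\<lambda>a. a \<noteq> m) \<pi>, tl (dropWhile (\<lambda>a. a \<noteq> m) \<pi>))" and
      i = "\<lambda>(B, \<alpha>, \<beta>). \<alpha> @ m # \<beta>"])
  fix \<pi> assume "\<pi> \<in> permutations_of_set (insert m A)"
  then have \<pi>: "set \<pi> = insert m A" "distinct \<pi>"
    by (auto simp: permutations_of_set_def)
  then obtain \<alpha> \<beta> where eq: "\<pi> = \<alpha> @ m # \<beta>" and "m \<notin> set \<alpha>"
    by (metis insertI1 split_list_first)
  then have parts: "takeWhile (\<lambda>a. a \<noteq> m) \<pi> = \<alpha>" "dropWhile (\<lambda>a. a \<noteq> m) \<pi> = m # \<beta>"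
    by (auto simp: takeWhile_append dropWhile_append)
  show "(case (set (takeWhile (\<lambda>a. a \<noteq> m) \<pi>), takeWhile (\<lambda>a. a \<noteq> m) \<pi>,
           tl (dropWhile (\<lambda>a. a \<noteq> m) \<pi>)) of (B, \<alpha>, \<beta>) \<Rightarrow> \<alpha> @ m # \<beta>) = \<pi>"
    unfolding parts by (simp add: eq)
  show "(set (takeWhile (\<lambda>a. a \<noteq> m) \<pi>), takeWhile (\<lambda>a. a \<noteq> m) \<pi>, tl (dropWhile (\<lambda>a. a \<noteq> m) \<pi>))
      \<in> (SIGMA B:Pow A. permutations_of_set B \<times> permutations_of_set (A - B))"
    using \<pi> assms unfolding parts by (auto simp: eq permutations_of_set_def)
  show "(case (set (takeWhile (\<lambda>a. a \<noteq> m) \<pi>), takeWhile (\<lambda>a. a \<noteq> m) \<pi>,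
           tl (dropWhile (\<lambda>a. a \<noteq> m) \<pi>)) of (B, \<alpha>, \<beta>) \<Rightarrow> f (\<alpha> @ m # \<beta>)) = f \<pi>"
    unfolding parts by (simp add: eq)
next
  fix p assume "p \<in> (SIGMA B:Pow A. permutations_of_set B \<times> permutations_of_set (A - B))"
  then obtain B \<alpha> \<beta> where p: "p = (B, \<alpha>, \<beta>)" "B \<subseteq> A"
    "set \<alpha> = B" "distinct \<alpha>" "set \<beta> = A - B" "distinct \<beta>"
    by (auto simp: permutations_of_set_def)
  have "m \<notin> set \<alpha>" using p assms by auto
  then have "takeWhile (\<lambda>a. a \<noteq> m) (\<alpha> @ m # \<beta>) = \<alpha>" "dropWhile (\<lambda>a. a \<noteq> m) (\<alpha> @ m # \<beta>) = m # \<beta>"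
    by (auto simp: takeWhile_append dropWhile_append)
  then show "(\<lambda>\<pi>. (set (takeWhile (\<lambda>a. a \<noteq> m) \<pi>), takeWhile (\<lambda>a. a \<noteq> m) \<pi>,
        tl (dropWhile (\<lambda>a. a \<noteq> m) \<pi>))) (case p of (B, \<alpha>, \<beta>) \<Rightarrow> \<alpha> @ m # \<beta>) = p"
    using p by simp
  show "(case p of (B, \<alpha>, \<beta>) \<Rightarrow> \<alpha> @ m # \<beta>) \<in> permutations_of_set (insert m A)"
    using p assms by (auto simp: permutations_of_set_def)
qed

lemma occ_weight_insert_least:
  assumes "finite A" "\<And>a. a \<in> A \<Longrightarrow> m < a"
  shows "occ_weight x (insert m A) =
    (\<Sum>B\<in>Pow A. (if 2 \<le> card B then x else 1) * occ_weight x B * occ_weight x (A - B))"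
proof -
  let ?w = "\<lambda>B. if 2 \<le> card B then x else 1"
  have "occ_weight x (insert m A) =
      (\<Sum>(B, \<alpha>, \<beta>)\<in>(SIGMA B:Pow A. permutations_of_set B \<times> permutations_of_set (A - B)).
         x ^ occ_231_321 (\<alpha> @ m # \<beta>))"
    unfolding occ_weight_def using assms(2) by (intro sum_permutations_of_set_insert) auto
  also have "\<dots> = (\<Sum>(B, \<alpha>, \<beta>)\<in>(SIGMA B:Pow A. permutations_of_set B \<times> permutations_of_set (A - B)).
         ?w B * (x ^ occ_231_321 \<alpha> * x ^ occ_231_321 \<beta>))"
  proof (intro sum.cong refl, clarify)
    fix B \<alpha> \<beta> assume "B \<subseteq> A" and "\<alpha> \<in> permutations_of_set B" "\<beta> \<in> permutations_of_set (A - B)"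
    then have *: "set \<alpha> = B" "distinct \<alpha>" "set \<beta> = A - B" "distinct \<beta>" "length \<alpha> = card B"
      by (auto simp: permutations_of_set_def distinct_card)
    have "occ_231_321 (\<alpha> @ m # \<beta>) =
        occ_231_321 \<alpha> + occ_231_321 \<beta> + (if 2 \<le> length \<alpha> then 1 else 0)"
      using * \<open>B \<subseteq> A\<close> assms(2) by (intro occ_split_at_least) auto
    then show "x ^ occ_231_321 (\<alpha> @ m # \<beta>) = ?w B * (x ^ occ_231_321 \<alpha> * x ^ occ_231_321 \<beta>)"
      using * by (simp add: power_add)
  qed
  also have "\<dots> = (\<Sum>B\<in>Pow A. \<Sum>(\<alpha>, \<beta>)\<in>permutations_of_set B \<times> permutations_of_set (A - B).
         ?w B * (x ^ occ_231_321 \<alpha> * x ^ occ_231_321 \<beta>))"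
    using assms(1) by (subst sum.Sigma) auto
  also have "\<dots> = (\<Sum>B\<in>Pow A. ?w B * occ_weight x B * occ_weight x (A - B))"
    by (simp only: occ_weight_def mult.assoc sum_product)
       (simp add: sum_distrib_left sum.cartesian_product split_def)
  finally show ?thesis .
qed

lemma sum_Pow_by_card:
  fixes f :: "nat \<Rightarrow> complex"
  assumes "finite A"
  shows "(\<Sum>B\<in>Pow A. f (card B)) = (\<Sum>k\<le>card A. of_nat (card A choose k) * f k)"
proof -
  have "(\<Sum>B\<in>Pow A. f (card B)) = (\<Sum>k\<le>card A. \<Sum>B\<in>{B \<in> Pow A. card B = k}. f (card B))"
    using assms by (intro sum.group[symmetric]) (auto intro: card_mono)
  also have "\<dots> = (\<Sum>k\<le>card A. of_nat (card A choose k) * f k)"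
    using assms by (intro sum.cong) (simp_all add: n_subsets)
  finally show ?thesis .
qed

text \<open>
  By strong induction, both factors in the sum over subsets depend on the subset only through its
  size, so no relabelling of words is needed to pass from a set of letters to an initial interval.
\<close>

lemma occ_weight_eq:
  fixes c :: "nat \<Rightarrow> complex"
  assumes c0: "c 0 = 1"
    and rec: "\<And>n. of_nat (Suc n) * c (Suc n) = (\<Sum>k\<le>n. (if 2 \<le> k then x else 1) * c k * c (n - k))"
    and "finite A"
  shows "occ_weight x A = fact (card A) * c (card A)"
  using \<open>finite A\<close>
proof (induction "card A" arbitrary: A rule: less_induct)
  case less
  show ?case
  proof (cases "A = {}")
    case True
    then show ?thesis by (simp add: occ_weight_def c0 occ_231_321_short)
  next
    case False
    define m where "m = Min A"
    define A' where "A' = A - {m}"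
    define n where "n = card A'"
    have "m \<in> A" and fin: "finite A'" using False less.prems by (auto simp: m_def A'_def)
    then have A: "A = insert m A'" by (auto simp: A'_def)
    have card: "card A = Suc n"
      using card.remove[OF less.prems \<open>m \<in> A\<close>] by (simp add: A'_def n_def)
    have least: "m < a" if "a \<in> A'" for a
      using that less.prems by (auto simp: m_def A'_def intro: le_neq_trans)
    have "occ_weight x A =
        (\<Sum>B\<in>Pow A'. (if 2 \<le> card B then x else 1) * occ_weight x B * occ_weight x (A' - B))"
      unfolding A using fin least by (rule occ_weight_insert_least)
    also have "\<dots> = (\<Sum>B\<in>Pow A'. (if 2 \<le> card B then x else 1) *
        (fact (card B) * c (card B)) * (fact (n - card B) * c (n - card B)))"
    proof (intro sum.cong refl)
      fix B assume "B \<in> Pow A'"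
      then have "B \<subseteq> A'" "finite B" using fin by (auto intro: finite_subset)
      then have "card B \<le> n" "card (A' - B) = n - card B"
        using fin by (auto simp: n_def card_mono card_Diff_subset)
      then show "(if 2 \<le> card B then x else 1) * occ_weight x B * occ_weight x (A' - B) =
          (if 2 \<le> card B then x else 1) * (fact (card B) * c (card B)) * (fact (n - card B) * c (n - card B))"
        using less.hyps[of B] less.hyps[of "A' - B"] card fin \<open>finite B\<close> by simp
    qed
    also have "\<dots> = (\<Sum>k\<le>n. of_nat (n choose k) *
        ((if 2 \<le> k then x else 1) * (fact k * c k) * (fact (n - k) * c (n - k))))"
      unfolding n_def by (rule sum_Pow_by_card[OF fin])
    also have "\<dots> = (\<Sum>k\<le>n. fact n * ((if 2 \<le> k then x else 1) * c k * c (n - k)))"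
    proof (intro sum.cong refl)
      fix k assume "k \<in> {..n}"
      then have "(fact n :: complex) = fact k * fact (n - k) * of_nat (n choose k)"
        using binomial_fact_lemma[of k n] by (metis atMost_iff of_nat_fact of_nat_mult)
      then show "of_nat (n choose k) *
          ((if 2 \<le> k then x else 1) * (fact k * c k) * (fact (n - k) * c (n - k))) =
          fact n * ((if 2 \<le> k then x else 1) * c k * c (n - k))"
        by simp
    qed
    also have "\<dots> = fact n * (of_nat (Suc n) * c (Suc n))"
      by (simp only: rec sum_distrib_left)
    also have "\<dots> = fact (card A) * c (card A)"
      by (simp add: card algebra_simps)
    finally show ?thesis .
  qed
qed

section \<open>The differential equation\<close>

text \<open>
  The polynomial \<open>1 + t\<close> in the equation is the part of the solution of degree below 2, as the
  first two coefficients turn out to be 1; this is what makes the sum a single convolution.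
\<close>

lemma bernoulli_fps_coeffs:
  fixes F :: "complex fps"
  assumes ode: "fps_deriv F = fps_const (1 - x) * (1 + fps_X) * F + fps_const x * (F * F)"
    and F0: "fps_nth F 0 = 1"
  shows "of_nat (Suc n) * fps_nth F (Suc n) =
    (\<Sum>k\<le>n. (if 2 \<le> k then x else 1) * fps_nth F k * fps_nth F (n - k))"
proof -
  have coeff: "of_nat (Suc n) * fps_nth F (Suc n) =
      (1 - x) * (fps_nth F n + (if n = 0 then 0 else fps_nth F (n - 1))) +
      x * (\<Sum>k\<le>n. fps_nth F k * fps_nth F (n - k))" for n
  proof -
    have "fps_nth (fps_deriv F) n = (1 - x) * fps_nth ((1 + fps_X) * F) n + x * fps_nth (F * F) n"
      unfolding ode by (simp only: fps_add_nth mult.assoc fps_mult_left_const_nth)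
    then show ?thesis
      by (simp add: ring_distribs fps_mult_nth[of F F] atLeast0AtMost)
  qed
  have F1: "fps_nth F (Suc 0) = 1"
    using coeff[of 0] F0 by simp
  have small: "(\<Sum>k\<le>n. if 2 \<le> k then 0 else fps_nth F k * fps_nth F (n - k)) =
      fps_nth F n + (if n = 0 then 0 else fps_nth F (n - 1))"
  proof (cases n)
    case (Suc m)
    have "(\<Sum>k\<le>n. if 2 \<le> k then 0 else fps_nth F k * fps_nth F (n - k)) =
        (\<Sum>k\<in>{0, 1}. fps_nth F k * fps_nth F (n - k))"
      by (rule sum.mono_neutral_cong_right) (auto simp: Suc)
    then show ?thesis by (simp add: F0 F1 Suc)
  qed (simp add: F0)
  have "(\<Sum>k\<le>n. (if 2 \<le> k then x else 1) * fps_nth F k * fps_nth F (n - k)) =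
      (\<Sum>k\<le>n. (1 - x) * (if 2 \<le> k then 0 else fps_nth F k * fps_nth F (n - k)) +
        x * (fps_nth F k * fps_nth F (n - k)))"
    by (intro sum.cong refl) (auto simp: algebra_simps)
  also have "\<dots> = (1 - x) * (fps_nth F n + (if n = 0 then 0 else fps_nth F (n - 1))) +
      x * (\<Sum>k\<le>n. fps_nth F k * fps_nth F (n - k))"
    by (simp only: sum.distrib sum_distrib_left[symmetric] small)
  finally show ?thesis using coeff[of n] by simp
qed

text \<open>
  An entire integrand has a primitive, and its increment is the integral along any segment.
\<close>

lemma DERIV_contour_integral_linepath_start:
  fixes f :: "complex \<Rightarrow> complex"
  assumes "f holomorphic_on UNIV"
  shows "((\<lambda>z. contour_integral (linepath z b) f) has_field_derivative - f z) (at z)"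
proof -
  obtain P where P: "\<And>z. (P has_field_derivative f z) (at z)"
    using holomorphic_convex_primitive'[of UNIV f] assms by auto
  have "contour_integral (linepath z b) f = P b - P z" for z
    using contour_integral_primitive[of UNIV P f "linepath z b"] P
    by (simp add: contour_integral_unique)
  then show ?thesis
    by (auto intro!: derivative_eq_intros P)
qed

theorem theorem1p6:
  fixes x :: complex
  shows "(\<lambda>t. exp (t * (t + 2) * (1 - x) / 2) /
              (1 + x * exp ((x - 1) / 2) *
                 contour_integral (linepath (t + 1) 1) (\<lambda>s. exp ((1 - x) / 2 * s ^ 2))))
         has_fps_expansion Abs_fps (\<lambda>n. L_poly n x / fact n)"
proof -
  define g where "g = (\<lambda>s. exp ((1 - x) / 2 * s ^ 2))"
  define N where "N = (\<lambda>t. exp (t * (t + 2) * (1 - x) / 2))"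
  define D where "D = (\<lambda>t. 1 + x * exp ((x - 1) / 2) * contour_integral (linepath (t + 1) 1) g)"
  define G where "G = (\<lambda>t. N t / D t)"
  have N': "(N has_field_derivative (1 - x) * (1 + t) * N t) (at t)" for t
    unfolding N_def by (auto intro!: derivative_eq_intros simp: field_simps)
  have D': "(D has_field_derivative - x * N t) (at t)" for t
  proof -
    have "g holomorphic_on UNIV" unfolding g_def by (intro holomorphic_intros)
    then have "((\<lambda>t. contour_integral (linepath (t + 1) 1) g) has_field_derivative - g (t + 1)) (at t)"
      by (intro DERIV_shift[THEN iffD1] DERIV_contour_integral_linepath_start)
    then have "(D has_field_derivative x * exp ((x - 1) / 2) * (- g (t + 1))) (at t)"
      unfolding D_def by (auto intro!: derivative_eq_intros)
    \<comment> \<open>completing the square: the exponents add up to \<open>t (t + 2) (1 - x) / 2\<close>\<close>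
    moreover have "exp ((x - 1) / 2) * g (t + 1) = N t"
      unfolding g_def N_def exp_add[symmetric]
      by (rule arg_cong[of _ _ exp]) (simp add: field_simps power2_eq_square)
    ultimately show ?thesis by (simp add: mult.assoc)
  qed
  have "isCont D 0" using D' by (rule DERIV_isCont)
  moreover have D0: "D 0 = 1" by (simp add: D_def)
  ultimately obtain e where e: "e > 0" and D_nz: "\<And>t. t \<in> ball 0 e \<Longrightarrow> D t \<noteq> 0"
    using continuous_at_avoid[of 0 D 0] by (auto simp: dist_commute)
  have G': "(G has_field_derivative (1 - x) * (1 + t) * G t + x * (G t * G t)) (at t)"
    if "t \<in> ball 0 e" for t
    unfolding G_def using D_nz[OF that]
    by (auto intro!: derivative_eq_intros N' D' simp: field_simps)
  have "G holomorphic_on ball 0 e"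
    by (rule holomorphic_onI) (meson G' field_differentiable_def field_differentiable_at_within)
  then have "G analytic_on {0}"
    using e unfolding analytic_at by (intro exI[of _ "ball 0 e"]) simp
  then obtain F where F: "G has_fps_expansion F"
    using analytic_at_imp_has_fps_expansion_0 by blast
  have F0: "fps_nth F 0 = 1"
    using has_fps_expansion_imp_0_eq_fps_nth_0[OF F] by (simp add: G_def N_def D0)
  have "deriv G has_fps_expansion fps_deriv F"
    using F by (rule has_fps_expansion_deriv)
  moreover have "\<forall>\<^sub>F t in nhds 0. deriv G t = (1 - x) * (1 + t) * G t + x * (G t * G t)"
  proof (rule eventually_mono)
    show "\<forall>\<^sub>F t in nhds 0. t \<in> ball 0 e"
      using e by (intro eventually_nhds_in_open) auto
  qed (intro DERIV_imp_deriv G')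
  ultimately have "(\<lambda>t. (1 - x) * (1 + t) * G t + x * (G t * G t)) has_fps_expansion fps_deriv F"
    by (subst has_fps_expansion_cong[symmetric]) auto
  moreover have "(\<lambda>t. (1 - x) * (1 + t) * G t + x * (G t * G t)) has_fps_expansion
      fps_const (1 - x) * (1 + fps_X) * F + fps_const x * (F * F)"
    by (intro fps_expansion_intros F)
  ultimately have "fps_deriv F = fps_const (1 - x) * (1 + fps_X) * F + fps_const x * (F * F)"
    by (rule fps_expansion_unique_complex)
  note rec = bernoulli_fps_coeffs[OF this F0]
  have "L_poly n x / fact n = fps_nth F n" for n
    using occ_weight_eq[of "fps_nth F" x "{1..n}", OF F0 rec] by (simp add: L_poly_eq_occ_weight)
  then have "Abs_fps (\<lambda>n. L_poly n x / fact n) = F"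
    by (simp add: fps_eq_iff)
  then show ?thesis using F by (simp add: G_def N_def D_def g_def)
qed

end
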